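(* For every integer $d\ge3$ there exists $c_d>0$ such that the polynomial $$(x)_d^2+(y)_d^2+c_d\,(x)_2(y)_2(x+y-2)_{d-1}(x+y-4)_{d-3}$$ in $\mathbb R[x,y]$ is positive and not a sum of squares.
   Context: The falling product is $(t)_m=\prod_{j=0}^{m-1}(t-j)$ (with $(t)_0=1$), and $(x)_d^2$ means $((x)_d)^2$. A real polynomial $p(x,y)$ is positive if $p(a)\ge0$ for all $a\in\mathbb R^2$; it is a sum of squares if it is a finite sum of squares of real polynomials. *)

theory Defs
  imports Complex_Main "HOL-Computational_Algebra.Polynomial"
begin

text \<open>
  The ring of real polynomials in \<open>x\<close> and \<open>y\<close> is represented as \<open>real poly poly\<close>:
  polynomials in \<open>y\<close> (outer variable) whose coefficients are polynomials in \<open>x\<close>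
  (inner variable).
\<close>

type_synonym bipoly = "real poly poly"

definition polyX :: bipoly where
  "polyX = [:[:0, 1:]:]"

definition polyY :: bipoly where
  "polyY = [:0, 1:]"

definition polyC :: "real \<Rightarrow> bipoly" where
  "polyC c = [:[:c:]:]"

text \<open>The inner \<open>poly\<close> substitutes the constant \<open>b\<close> for \<open>y\<close>, the outer one \<open>a\<close> for \<open>x\<close>.\<close>

definition eval2 :: "bipoly \<Rightarrow> real \<times> real \<Rightarrow> real" where
  "eval2 p = (\<lambda>(a, b). poly (poly p [:b:]) a)"

lemma eval2_simps [simp]:
  "eval2 polyX (a, b) = a"
  "eval2 polyY (a, b) = b"
  "eval2 (polyC c) (a, b) = c"
  "eval2 (p + q) (a, b) = eval2 p (a, b) + eval2 q (a, b)"
  "eval2 (p - q) (a, b) = eval2 p (a, b) - eval2 q (a, b)"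
  "eval2 (p * q) (a, b) = eval2 p (a, b) * eval2 q (a, b)"
  by (simp_all add: eval2_def polyX_def polyY_def polyC_def)

definition falling :: "'a::comm_ring_1 \<Rightarrow> nat \<Rightarrow> 'a" where
  "falling t m = (\<Prod>j<m. t - of_nat j)"

definition positive_poly :: "bipoly \<Rightarrow> bool" where
  "positive_poly p \<longleftrightarrow> (\<forall>a. eval2 p a \<ge> 0)"

definition sum_of_squares :: "bipoly \<Rightarrow> bool" where
  "sum_of_squares p \<longleftrightarrow> (\<exists>qs :: bipoly list. p = (\<Sum>q\<leftarrow>qs. q\<^sup>2))"

end

(*
  Not a sum of squares: let q occur in a representation p = sum of q^2. Comparing degrees along the
  lines y = v x shows that q has total degree at most d, so the second difference
  q(0,y) - 2 q(1,y) + q(2,y) has degree at most d - 2 in y. Since p, hence q, vanishes at all points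
  (i,j) with i <= 2, j <= d - 1 other than (2,d-1), this difference has the d - 1 roots 0,...,d-2
  and is zero; evaluated at y = d - 1 it gives q(2,d-1) = 0. But p(2,d-1) > 0.

  Positivity: let (i,j) be the point of the grid {0,...,d-1}^2 closest to (x,y) and m the larger of
  |x-i| and |y-j|. Then (x)_d^2 + (y)_d^2 is at least a constant times m^2 (1+m)^(2d-2). The last
  summand is a product of 2d linear forms, each at most a constant times 1+m. Either two of them
  vanish at (i,j) and are therefore at most a constant times m, or all of them are at least 1 at
  (i,j), so that the product is nonnegative for m <= 1/2, while 1+m <= 3m otherwise.
*)
theory Submission imports Defs begin

section \<open>Evaluation at points of the plane\<close>

lemma eval2_power [simp]: "eval2 (p ^ n) (a, b) = eval2 p (a, b) ^ n"
  by (simp add: eval2_def poly_power)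

lemma eval2_of_nat [simp]: "eval2 (of_nat n) (a, b) = of_nat n"
  by (induction n) (simp_all add: eval2_def)

lemma eval2_numeral [simp]: "eval2 (numeral n) (a, b) = numeral n"
  using eval2_of_nat[of "numeral n" a b] by simp

lemma eval2_falling [simp]: "eval2 (falling p n) (a, b) = falling (eval2 p (a, b)) n"
  unfolding falling_def
proof (induction n)
  case 0
  show ?case by (simp add: eval2_def)
qed (simp add: mult.commute)

lemma eval2_sum_list: "eval2 (\<Sum>q\<leftarrow>qs. f q) (a, b) = (\<Sum>q\<leftarrow>qs. eval2 (f q) (a, b))"
  by (induction qs) (simp_all add: eval2_def)

section \<open>Zeros, signs and size of falling products\<close>

lemma falling_of_nat_eq_0:
  assumes "n < m"
  shows "falling (of_nat n :: 'a::comm_ring_1) m = 0"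
  using assms unfolding falling_def by (intro prod_zero) auto

lemma falling_nonneg:
  fixes t :: real
  assumes "t \<ge> real m - 1"
  shows "falling t m \<ge> 0"
  unfolding falling_def using assms by (intro prod_nonneg) auto

lemma falling_pos:
  fixes t :: real
  assumes "t > real m - 1"
  shows "falling t m > 0"
  unfolding falling_def using assms by (intro prod_pos) auto

lemma abs_falling_le:
  fixes t :: real
  assumes "\<And>k. k < m \<Longrightarrow> \<bar>t - real k\<bar> \<le> L"
  shows "\<bar>falling t m\<bar> \<le> L ^ m"
proof -
  have "(\<Prod>k<m. \<bar>t - real k\<bar>) \<le> (\<Prod>k<m. L)"
    using assms by (intro prod_mono) auto
  thus ?thesis by (simp add: falling_def abs_prod)
qed

text \<open>The factor at the root \<open>n\<close> gains \<open>\<rho>\<close> over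
  \<open>abs_falling_le\<close>. Two such gains in the mixed term will match the quadratic vanishing
  of the two squares at a grid point.\<close>

lemma abs_falling_le_near_root:
  fixes t :: real
  assumes "\<And>k. k < m \<Longrightarrow> \<bar>t - real k\<bar> \<le> L"
    and "n < m" and "\<bar>t - real n\<bar> \<le> \<rho> * L"
  shows "\<bar>falling t m\<bar> \<le> \<rho> * L ^ m"
proof -
  have "\<bar>falling t m\<bar> = \<bar>t - real n\<bar> * (\<Prod>k\<in>{..<m} - {n}. \<bar>t - real k\<bar>)"
    using assms(2) by (simp add: falling_def abs_mult abs_prod prod.remove[of "{..<m}" n])
  also have "\<dots> \<le> (\<rho> * L) * (\<Prod>k\<in>{..<m} - {n}. L)"
    using assms by (intro mult_mono prod_mono prod_nonneg) auto
  also have "\<dots> = \<rho> * L ^ m"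
    using assms(2) by (cases m) simp_all
  finally show ?thesis .
qed

text \<open>For the nearest \<open>i\<close>, 1 + |x - i| <= 2 |x - i| + |x - k| <= 3 |x - k|,
  whence the divisor 3.\<close>

lemma obtain_nearest:
  fixes x :: real
  assumes "d > 0"
  obtains i where "i < d" "\<And>k. k < d \<Longrightarrow> k \<noteq> i \<Longrightarrow> (1 + \<bar>x - real i\<bar>) / 3 \<le> \<bar>x - real k\<bar>"
proof -
  obtain i where i: "is_arg_min (\<lambda>k. \<bar>x - real k\<bar>) (\<lambda>k. k \<in> {..<d}) i"
    using ex_is_arg_min_if_finite[of "{..<d}" "\<lambda>k. \<bar>x - real k\<bar>"] assms by auto
  show ?thesis
  proof (rule that[of i])
    show "i < d" using i by (simp add: is_arg_min_def)
  next
    fix k assume k: "k < d" "k \<noteq> i"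
    have "\<bar>x - real i\<bar> \<le> \<bar>x - real k\<bar>"
      using i k by (simp add: is_arg_min_linorder)
    moreover have "1 \<le> \<bar>x - real i\<bar> + \<bar>x - real k\<bar>"
      using k by linarith
    ultimately show "(1 + \<bar>x - real i\<bar>) / 3 \<le> \<bar>x - real k\<bar>"
      by simp
  qed
qed

text \<open>Only the factor at \<open>i\<close> can be small, so it is kept; each of the other
  \<open>d - 1\<close> factors is replaced by its lower bound.\<close>

lemma falling_power2_ge:
  fixes x :: real
  assumes "i < d" and "\<And>k. k < d \<Longrightarrow> k \<noteq> i \<Longrightarrow> (1 + \<bar>x - real i\<bar>) / 3 \<le> \<bar>x - real k\<bar>"
  shows "\<bar>x - real i\<bar>\<^sup>2 * ((1 + \<bar>x - real i\<bar>) / 3) ^ (2 * (d - 1)) \<le> (falling x d)\<^sup>2"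
proof -
  let ?M = "(1 + \<bar>x - real i\<bar>) / 3"
  have "\<bar>x - real i\<bar> * ?M ^ (d - 1) = \<bar>x - real i\<bar> * (\<Prod>k\<in>{..<d} - {i}. ?M)"
    using assms(1) by simp
  also have "\<dots> \<le> \<bar>x - real i\<bar> * (\<Prod>k\<in>{..<d} - {i}. \<bar>x - real k\<bar>)"
    using assms by (intro mult_left_mono prod_mono) auto
  also have "\<dots> = \<bar>falling x d\<bar>"
    using assms(1) by (simp add: falling_def abs_mult abs_prod prod.remove[of "{..<d}" i])
  finally have "(\<bar>x - real i\<bar> * ?M ^ (d - 1))\<^sup>2 \<le> \<bar>falling x d\<bar>\<^sup>2"
    by (intro power_mono) auto
  thus ?thesis
    by (simp add: power_mult_distrib power_mult mult.commute flip: power_mult)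
qed

section \<open>The mixed term against the two squares\<close>

lemma abs_mult4_le:
  fixes a b c e A B C E :: real
  assumes "\<bar>a\<bar> \<le> A" "\<bar>b\<bar> \<le> B" "\<bar>c\<bar> \<le> C" "\<bar>e\<bar> \<le> E"
  shows "\<bar>a * b * c * e\<bar> \<le> A * B * C * E"
  unfolding abs_mult using assms by (intro mult_mono mult_nonneg_nonneg) auto

definition mixed_term :: "nat \<Rightarrow> real \<Rightarrow> real \<Rightarrow> real" where
  "mixed_term d x y =
     falling x 2 * falling y 2 * falling (x + y - 2) (d - 1) * falling (x + y - 4) (d - 3)"

lemma mixed_term_lower_bound:
  fixes x y :: real
  assumes d: "d \<ge> 3"
  shows "- (9 ^ d * (2 * real d) ^ (2 * d) * ((falling x d)\<^sup>2 + (falling y d)\<^sup>2))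
           \<le> mixed_term d x y"
proof -
  obtain i where i: "i < d"
    "\<And>k. k < d \<Longrightarrow> k \<noteq> i \<Longrightarrow> (1 + \<bar>x - real i\<bar>) / 3 \<le> \<bar>x - real k\<bar>"
    using obtain_nearest[of d x] d by auto
  obtain j where j: "j < d"
    "\<And>k. k < d \<Longrightarrow> k \<noteq> j \<Longrightarrow> (1 + \<bar>y - real j\<bar>) / 3 \<le> \<bar>y - real k\<bar>"
    using obtain_nearest[of d y] d by auto
  define \<mu> where "\<mu> = max \<bar>x - real i\<bar> \<bar>y - real j\<bar>"
  define M where "M = 1 + \<mu>"
  \<comment> \<open>The linear forms in the mixed term turn out to be at most
    \<open>L = N + N * \<mu>\<close> in absolute value. Those vanishing at \<open>(i, j)\<close> are
    at most \<open>2 * \<mu>\<close>, hence at most \<open>N * \<mu> = \<rho> * L\<close>.\<close>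
  define N where "N = 2 * real d"
  define L where "L = N * M"
  define \<rho> where "\<rho> = \<mu> / M"
  define h where "h = (falling x d)\<^sup>2 + (falling y d)\<^sup>2"
  have \<mu>0: "\<mu> \<ge> 0" and ax: "\<bar>x - real i\<bar> \<le> \<mu>" and ay: "\<bar>y - real j\<bar> \<le> \<mu>"
    by (auto simp: \<mu>_def)
  have M: "M > 0" using \<mu>0 by (simp add: M_def)
  have N: "N \<ge> 6" using d by (simp add: N_def)
  have \<rho>0: "\<rho> \<ge> 0" using \<mu>0 M by (simp add: \<rho>_def)
  have \<rho>L: "\<rho> * L = N * \<mu>" using M by (simp add: \<rho>_def L_def)
  have L: "L = N + N * \<mu>" by (simp add: L_def M_def algebra_simps)
  have N\<mu>: "2 * \<mu> \<le> N * \<mu>" using N \<mu>0 by (intro mult_right_mono) auto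
  have L0: "L \<ge> 0" using N M by (simp add: L_def)

  have h_ge: "\<mu>\<^sup>2 * (M / 3) ^ (2 * (d - 1)) \<le> h"
  proof (cases "\<bar>x - real i\<bar> \<ge> \<bar>y - real j\<bar>")
    case True
    hence "\<mu> = \<bar>x - real i\<bar>" by (simp add: \<mu>_def)
    thus ?thesis
      using falling_power2_ge[of i d x, OF i] by (simp add: M_def h_def add_increasing2)
  next
    case False
    hence "\<mu> = \<bar>y - real j\<bar>" by (simp add: \<mu>_def)
    thus ?thesis
      using falling_power2_ge[of j d y, OF j] by (simp add: M_def h_def add_increasing)
  qed
  \<comment> \<open>Here \<open>\<rho> * L = N * \<mu>\<close> turns two of the \<open>2 * d\<close>
    factors \<open>L\<close> into \<open>\<mu>\<close>, and passing from \<open>M\<close> to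
    \<open>M / 3\<close> in the others costs 9 to the power \<open>d - 1\<close>.\<close>
  have "9 * \<rho>\<^sup>2 * L ^ (2 * d) = 9 ^ d * N ^ (2 * d) * (\<mu>\<^sup>2 * (M / 3) ^ (2 * (d - 1)))"
  proof -
    obtain e where e: "d = Suc e" using d by (cases d) auto
    have "(3::real) ^ (2 * e) = 9 ^ e" by (simp add: power_mult)
    thus ?thesis
      using M by (simp add: e \<rho>_def L_def power_mult_distrib power_divide power2_eq_square)
  qed
  also have "\<dots> \<le> 9 ^ d * N ^ (2 * d) * h"
    using h_ge N by (intro mult_left_mono) auto
  finally have bound: "9 * \<rho>\<^sup>2 * L ^ (2 * d) \<le> 9 ^ d * N ^ (2 * d) * h" .

  have lin_x: "\<bar>x - real k\<bar> \<le> L" if "k < 2" for k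
    using that i d ax N\<mu> L N_def by linarith
  have lin_y: "\<bar>y - real k\<bar> \<le> L" if "k < 2" for k
    using that j d ay N\<mu> L N_def by linarith
  have lin_u: "\<bar>x + y - 2 - real k\<bar> \<le> L" if "k < d - 1" for k
    using that i j d ax ay N\<mu> L N_def by linarith
  have lin_v: "\<bar>x + y - 4 - real k\<bar> \<le> L" if "k < d - 3" for k
    using that i j d ax ay N\<mu> L N_def by linarith
  have fx: "\<bar>falling x 2\<bar> \<le> L ^ 2" by (intro abs_falling_le lin_x)
  have fy: "\<bar>falling y 2\<bar> \<le> L ^ 2" by (intro abs_falling_le lin_y)
  have fu: "\<bar>falling (x + y - 2) (d - 1)\<bar> \<le> L ^ (d - 1)" by (intro abs_falling_le lin_u)
  have fv: "\<bar>falling (x + y - 4) (d - 3)\<bar> \<le> L ^ (d - 3)" by (intro abs_falling_le lin_v)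
  have gx: "\<bar>falling x 2\<bar> \<le> \<rho> * L ^ 2" if "i < 2"
    using that ax N\<mu> \<mu>0 \<rho>L by (intro abs_falling_le_near_root[of _ _ _ i] lin_x) auto
  have gy: "\<bar>falling y 2\<bar> \<le> \<rho> * L ^ 2" if "j < 2"
    using that ay N\<mu> \<mu>0 \<rho>L by (intro abs_falling_le_near_root[of _ _ _ j] lin_y) auto
  \<comment> \<open>The sum \<open>i + j\<close> hits a root of this product for 2 <= i + j <= d,
    and one of the next product for 4 <= i + j <= d.\<close>
  have gu: "\<bar>falling (x + y - 2) (d - 1)\<bar> \<le> \<rho> * L ^ (d - 1)" if "2 \<le> i + j" "i + j \<le> d"
  proof (rule abs_falling_le_near_root[of _ _ _ "i + j - 2"])
    show "\<bar>x + y - 2 - real (i + j - 2)\<bar> \<le> \<rho> * L"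
      using that ax ay N\<mu> unfolding \<rho>L by (simp add: of_nat_diff)
  qed (use that d lin_u in auto)
  have gv: "\<bar>falling (x + y - 4) (d - 3)\<bar> \<le> \<rho> * L ^ (d - 3)" if "4 \<le> i + j" "i + j \<le> d"
  proof (rule abs_falling_le_near_root[of _ _ _ "i + j - 4"])
    show "\<bar>x + y - 4 - real (i + j - 4)\<bar> \<le> \<rho> * L"
      using that ax ay N\<mu> unfolding \<rho>L by (simp add: of_nat_diff)
  qed (use that d lin_v in auto)
  have L_split: "L ^ (2 * d) = L ^ 2 * L ^ 2 * L ^ (d - 1) * L ^ (d - 3)"
  proof -
    have "2 * d = 2 + 2 + (d - 1) + (d - 3)" using d by simp
    thus ?thesis by (metis power_add)
  qed

  have "- (9 * \<rho>\<^sup>2 * L ^ (2 * d)) \<le> mixed_term d x y"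
  proof (cases "2 \<le> i \<and> 2 \<le> j \<and> d < i + j")
    case False
    \<comment> \<open>If one index is below 2, then \<open>i + j \<le> d\<close> because the other
      is at most \<open>d - 1\<close>. So each case provides two falling products with a root at
      \<open>(i, j)\<close>.\<close>
    then consider "i < 2" "j < 2" | "i < 2" "2 \<le> i + j" "i + j \<le> d"
      | "j < 2" "2 \<le> i + j" "i + j \<le> d" | "4 \<le> i + j" "i + j \<le> d"
      using i(1) j(1) by linarith
    hence "\<bar>mixed_term d x y\<bar> \<le> \<rho>\<^sup>2 * L ^ (2 * d)"
    proof cases
      case 1
      show ?thesis using abs_mult4_le[OF gx[OF 1(1)] gy[OF 1(2)] fu fv]
        unfolding mixed_term_def L_split by (simp add: power2_eq_square mult_ac)
    next
      case 2
      show ?thesis using abs_mult4_le[OF gx[OF 2(1)] fy gu[OF 2(2,3)] fv]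
        unfolding mixed_term_def L_split by (simp add: power2_eq_square mult_ac)
    next
      case 3
      show ?thesis using abs_mult4_le[OF fx gy[OF 3(1)] gu[OF 3(2,3)] fv]
        unfolding mixed_term_def L_split by (simp add: power2_eq_square mult_ac)
    next
      case 4
      have "2 \<le> i + j" using 4 by simp
      show ?thesis using abs_mult4_le[OF fx fy gu[OF \<open>2 \<le> i + j\<close> 4(2)] gv[OF 4]]
        unfolding mixed_term_def L_split by (simp add: power2_eq_square mult_ac)
    qed
    moreover have "0 \<le> \<rho>\<^sup>2 * L ^ (2 * d)" using L0 by simp
    ultimately show ?thesis by linarith
  next
    case True
    hence ij: "2 \<le> real i" "2 \<le> real j" "real d + 1 \<le> real i + real j" by linarith+
    show ?thesis
    proof (cases "\<mu> \<le> 1 / 2")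
      case True
      \<comment> \<open>The sum moves by at most \<open>2 * \<mu> \<le> 1\<close>, so
        \<open>x + y \<ge> d\<close>: exactly the threshold of \<open>falling_nonneg\<close> for
        both products in \<open>x + y\<close>.\<close>
      have "0 \<le> mixed_term d x y"
        unfolding mixed_term_def
        using ij True ax ay d by (intro mult_nonneg_nonneg falling_nonneg) (auto simp: of_nat_diff)
      moreover have "0 \<le> 9 * \<rho>\<^sup>2 * L ^ (2 * d)" using L0 by simp
      ultimately show ?thesis by linarith
    next
      case False
      \<comment> \<open>Far from the grid the crude bound by a power of \<open>L\<close> suffices;
        the factor 9 in the claim makes up for \<open>\<rho>\<close> being possibly as small as
        1/3.\<close>
      hence "1 / 3 \<le> \<rho>" using M by (simp add: \<rho>_def M_def field_simps)
      hence "(1 / 3)\<^sup>2 \<le> \<rho>\<^sup>2" by (intro power_mono) auto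
      hence "1 \<le> 9 * \<rho>\<^sup>2" by (simp add: power2_eq_square)
      hence "1 * L ^ (2 * d) \<le> 9 * \<rho>\<^sup>2 * L ^ (2 * d)"
        using L0 by (intro mult_right_mono) auto
      moreover have "\<bar>mixed_term d x y\<bar> \<le> L ^ (2 * d)"
        using abs_mult4_le[OF fx fy fu fv] unfolding mixed_term_def L_split .
      ultimately show ?thesis by linarith
    qed
  qed
  with bound show ?thesis by (simp add: h_def N_def)
qed

section \<open>Degrees of squares and total degree\<close>

lemma degree_le_of_sum_list_squares:
  fixes qs :: "'a::linordered_idom poly list"
  assumes "q \<in> set qs"
  shows "2 * degree q \<le> degree (\<Sum>q\<leftarrow>qs. q\<^sup>2)"
proof -
  \<comment> \<open>Leading coefficients of squares are nonnegative, so top terms never cancel. The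
    sign is carried along as an invariant of the induction over the list.\<close>
  have sq: "2 * degree q \<le> degree (q\<^sup>2 + s) \<and> degree s \<le> degree (q\<^sup>2 + s)
      \<and> 0 \<le> lead_coeff (q\<^sup>2 + s)" if "0 \<le> lead_coeff s" for q s :: "'a poly"
  proof -
    have lq: "lead_coeff (q\<^sup>2) = (lead_coeff q)\<^sup>2"
      by (simp add: lead_coeff_power)
    have dq: "degree (q\<^sup>2) = 2 * degree q"
      by (cases "q = 0") (simp_all add: degree_power_eq)
    show ?thesis
    proof (cases "degree (q\<^sup>2)" "degree s" rule: linorder_cases)
      case less
      thus ?thesis using that dq by (simp add: degree_add_eq_right coeff_eq_0)
    next
      case greater
      thus ?thesis using dq lq by (simp add: degree_add_eq_left coeff_eq_0)
    next
      case equal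
      show ?thesis
      proof (cases "q = 0")
        case True
        thus ?thesis using that by simp
      next
        case False
        hence "0 < coeff (q\<^sup>2) (degree s) + coeff s (degree s)"
          using lq that by (simp add: equal add_pos_nonneg)
        hence pos: "0 < coeff (q\<^sup>2 + s) (degree s)" by simp
        have "degree (q\<^sup>2 + s) \<le> degree s"
          using equal by (intro degree_add_le) simp_all
        moreover have "degree s \<le> degree (q\<^sup>2 + s)"
          using pos by (intro le_degree) simp
        ultimately have "degree (q\<^sup>2 + s) = degree s" by simp
        thus ?thesis using pos equal dq by simp
      qed
    qed
  qed
  have nonneg: "0 \<le> lead_coeff (\<Sum>q\<leftarrow>qs. q\<^sup>2)" for qs :: "'a poly list"
    by (induction qs) (use sq in auto)
  show ?thesis using assms
  proof (induction qs)
    case (Cons r rs)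
    thus ?case using sq[OF nonneg[of rs], of r] by fastforce
  qed simp
qed

lemma degree_falling_le:
  assumes "degree (p :: 'a::comm_ring_1 poly) \<le> 1"
  shows "degree (falling p n) \<le> n"
proof -
  have "degree (falling p n) \<le> (\<Sum>j<n. degree (p - of_nat j))"
    unfolding falling_def using degree_prod_sum_le[of "{..<n}" "\<lambda>j. p - of_nat j"]
    by (simp add: comp_def)
  also have "\<dots> \<le> (\<Sum>j<n. 1)"
    using assms by (intro sum_mono degree_diff_le) simp_all
  finally show ?thesis by simp
qed

lemma poly_falling: "poly (falling p n) z = falling (poly p z) n"
  unfolding falling_def by (simp add: poly_prod)

text \<open>Substituting \<open>[:0, v:]\<close> for the outer variable restricts a polynomial to the line
  \<open>y = v x\<close>, and the coefficients of the restriction are the homogeneous parts at \<open>(1, v)\<close>.\<close>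

lemma coeff_poly_line:
  fixes q :: "'a::comm_ring_1 poly poly"
  shows "coeff (poly q [:0, v:]) k = (\<Sum>j\<le>k. coeff (coeff q j) (k - j) * v ^ j)"
proof (induction q arbitrary: k)
  case 0
  show ?case by simp
next
  case (pCons c q)
  show ?case
  proof (cases k)
    case 0
    thus ?thesis by simp
  next
    case (Suc m)
    have "coeff (poly (pCons c q) [:0, v:]) k = coeff c k + v * coeff (poly q [:0, v:]) m"
      by (simp add: Suc)
    also have "\<dots> = (\<Sum>j\<le>k. coeff (coeff (pCons c q) j) (k - j) * v ^ j)"
      unfolding pCons.IH Suc sum.atMost_Suc_shift by (simp add: sum_distrib_left mult_ac)
    finally show ?thesis .
  qed
qed

text \<open>The coefficient of degree \<open>i + j\<close> on the line is a polynomial in the slope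
  \<open>v\<close>, with the coefficient in question at \<open>v ^ j\<close>. It vanishes for all
  \<open>v\<close>, hence identically.\<close>

lemma coeff_eq_0_of_degree_lines_le:
  fixes q :: "'a::{idom, ring_char_0} poly poly"
  assumes "\<And>v. degree (poly q [:0, v:]) \<le> n" and "i + j > n"
  shows "coeff (coeff q j) i = 0"
proof -
  define P where "P = (\<Sum>l\<le>i + j. monom (coeff (coeff q l) (i + j - l)) l)"
  have "poly P v = coeff (poly q [:0, v:]) (i + j)" for v
    by (simp add: P_def poly_sum poly_monom coeff_poly_line)
  also have "coeff (poly q [:0, v:]) (i + j) = 0" for v
    using assms by (intro coeff_eq_0 le_less_trans[OF assms(1)])
  finally have "P = 0" by (simp add: poly_all_0_iff_0[symmetric])
  hence "coeff P j = 0" by simp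
  thus ?thesis by (simp add: P_def coeff_sum sum.delta)
qed

text \<open>A second difference in x kills coefficients of x-degree at most 1. By the total degree
  bound these include the coefficients of \<open>y ^ j\<close> for all \<open>j \<ge> n\<close>, so
  a polynomial in y of degree below \<open>n\<close> with \<open>n\<close> roots is left.\<close>

lemma eval2_second_difference_eq_0:
  fixes q :: bipoly
  assumes tdeg: "\<And>i j. i + j > Suc n \<Longrightarrow> coeff (coeff q j) i = 0"
    and zeros: "\<And>j. j < n \<Longrightarrow>
      eval2 q (0, real j) - 2 * eval2 q (1, real j) + eval2 q (2, real j) = 0"
  shows "eval2 q (0, b) - 2 * eval2 q (1, b) + eval2 q (2, b) = 0"
proof -
  define \<Delta> :: "real poly \<Rightarrow> real" where "\<Delta> c = poly c 0 - 2 * poly c 1 + poly c 2" for c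
  \<comment> \<open>As \<open>\<Delta>\<close> is linear, applying it coefficientwise gives the
    second difference as a polynomial in y.\<close>
  define r where "r = map_poly \<Delta> q"
  have [simp]: "\<Delta> 0 = 0" by (simp add: \<Delta>_def)
  have poly_r: "poly r b = eval2 q (0, b) - 2 * eval2 q (1, b) + eval2 q (2, b)" for b
    unfolding r_def
  proof (induction q)
    case 0
    show ?case by (simp add: eval2_def)
  next
    case (pCons c q)
    show ?case
      using arg_cong[OF pCons.IH, of "(*) b"] pCons.hyps
      by (simp add: eval2_def map_poly_pCons \<Delta>_def algebra_simps)
  qed
  have high: "coeff r j = 0" if "n \<le> j" for j
  proof -
    have "degree (coeff q j) \<le> 1"
      using tdeg that by (intro degree_le) auto
    then obtain \<alpha> \<beta> where "coeff q j = [:\<alpha>, \<beta>:]"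
      by (metis degree1_coeffs degree_eq_zeroE le_neq_implies_less less_one pCons_0_0)
    thus ?thesis by (simp add: r_def coeff_map_poly \<Delta>_def)
  qed
  have "r = 0"
  proof (rule ccontr)
    assume r: "r \<noteq> 0"
    hence "degree r < n" using high by (meson leading_coeff_0_iff not_less)
    moreover have "real ` {..<n} \<subseteq> {b. poly r b = 0}"
      using zeros by (auto simp: poly_r)
    hence "card (real ` {..<n}) \<le> card {b. poly r b = 0}"
      using r by (intro card_mono poly_roots_finite)
    ultimately show False
      using card_poly_roots_bound[OF r] by (simp add: card_image)
  qed
  thus ?thesis using poly_r[of b] by simp
qed

theorem mainTheorem10:
  fixes d :: nat
  assumes "d \<ge> 3"
  shows "\<exists>c :: real. c > 0 \<and>
    (let p = (falling polyX d)\<^sup>2 + (falling polyY d)\<^sup>2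
           + polyC c * falling polyX 2 * falling polyY 2
             * falling (polyX + polyY - 2) (d - 1)
             * falling (polyX + polyY - 4) (d - 3)
     in positive_poly p \<and> \<not> sum_of_squares p)"
proof -
  define K where "K = 9 ^ d * (2 * real d) ^ (2 * d)"
  \<comment> \<open>This choice turns \<open>mixed_term_lower_bound\<close> into the lower bound
    minus the two squares.\<close>
  define c where "c = 1 / K"
  define p where "p = (falling polyX d)\<^sup>2 + (falling polyY d)\<^sup>2
           + polyC c * falling polyX 2 * falling polyY 2
             * falling (polyX + polyY - 2) (d - 1)
             * falling (polyX + polyY - 4) (d - 3)"
  have K: "K > 0" using assms by (simp add: K_def)
  hence c: "c > 0" by (simp add: c_def)
  have eval_p: "eval2 p (x, y) = (falling x d)\<^sup>2 + (falling y d)\<^sup>2 + c * mixed_term d x y" for x y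
    by (simp add: p_def mixed_term_def)
  have "positive_poly p"
    unfolding positive_poly_def
  proof
    fix z :: "real \<times> real"
    obtain x y where z: "z = (x, y)" by (cases z)
    have "c * (- (K * ((falling x d)\<^sup>2 + (falling y d)\<^sup>2))) \<le> c * mixed_term d x y"
      using mixed_term_lower_bound[OF assms, of x y] c by (intro mult_left_mono) (auto simp: K_def)
    thus "0 \<le> eval2 p z"
      unfolding z eval_p using K by (simp add: c_def)
  qed
  moreover have "\<not> sum_of_squares p"
  proof
    assume "sum_of_squares p"
    then obtain qs where p_eq: "p = (\<Sum>q\<leftarrow>qs. q\<^sup>2)"
      by (auto simp: sum_of_squares_def)
    have sum_sq: "eval2 p (x, y) = (\<Sum>q\<leftarrow>qs. (eval2 q (x, y))\<^sup>2)" for x y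
      by (simp add: p_eq eval2_sum_list)
    have q_zero: "eval2 q (x, y) = 0" if "q \<in> set qs" "eval2 p (x, y) = 0" for q x y
      using that unfolding sum_sq by (subst (asm) sum_list_nonneg_eq_0_iff) auto
    have p_zero: "eval2 p (real i, real j) = 0"
      if "i \<le> 2" "j \<le> d - 1" "(i, j) \<noteq> (2, d - 1)" for i j
    proof -
      have "falling (real i) d = 0" "falling (real j) d = 0"
        using that assms by (auto intro!: falling_of_nat_eq_0)
      moreover have "mixed_term d (real i) (real j) = 0"
      proof (cases "i < 2 \<or> j < 2")
        case True
        thus ?thesis using falling_of_nat_eq_0[of _ 2, where 'a = real] by (auto simp: mixed_term_def)
      next
        case False
        \<comment> \<open>On the column x = 2 the form \<open>x + y - 2\<close> equals
          \<open>j\<close>, a root of the product of length \<open>d - 1\<close>; this fails at the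
          excluded \<open>j = d - 1\<close>.\<close>
        hence "i = 2" "j < d - 1" using that by auto
        thus ?thesis using falling_of_nat_eq_0[of j "d - 1", where 'a = real]
          by (simp add: mixed_term_def)
      qed
      ultimately show ?thesis by (simp add: eval_p)
    qed
    have "degree (poly p [:0, v:]) \<le> 2 * d" for v
    proof -
      define a b s :: "real poly" where "a = [:0, 1:]" "b = [:0, v:]" "s = a + b"
      have deg: "degree a \<le> 1" "degree b \<le> 1" "degree (s - 2) \<le> 1" "degree (s - 4) \<le> 1"
        by (auto simp: a_b_s_def numeral_poly)
      have "poly p b = (falling a d)\<^sup>2 + (falling b d)\<^sup>2
           + [:c:] * falling a 2 * falling b 2 * falling (s - 2) (d - 1) * falling (s - 4) (d - 3)"
        by (simp add: p_def poly_falling poly_power polyX_def polyY_def polyC_def a_b_s_def)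
      moreover have "degree ((falling a d)\<^sup>2) \<le> 2 * d" "degree ((falling b d)\<^sup>2) \<le> 2 * d"
        using degree_falling_le[OF deg(1), of d] degree_falling_le[OF deg(2), of d]
        by (metis degree_power_le mult.commute mult_le_mono1 order_trans)+
      \<comment> \<open>The five bounds add up to exactly \<open>2 * d\<close>.\<close>
      moreover have "degree ([:c:] * falling a 2 * falling b 2 * falling (s - 2) (d - 1)
          * falling (s - 4) (d - 3)) \<le> 0 + 2 + 2 + (d - 1) + (d - 3)"
        by (intro order_trans[OF degree_mult_le] add_mono degree_falling_le deg) simp
      ultimately show ?thesis
        unfolding a_b_s_def(2)[symmetric] using assms
        by (auto intro!: degree_add_le)
    qed
    moreover have "poly p z = (\<Sum>q\<leftarrow>map (\<lambda>q. poly q z) qs. q\<^sup>2)" for z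
      unfolding p_eq by (induction qs) (simp_all add: poly_power)
    ultimately have line_degree: "degree (poly q [:0, v:]) \<le> d" if "q \<in> set qs" for q v
      using degree_le_of_sum_list_squares[of "poly q [:0, v:]" "map (\<lambda>q. poly q [:0, v:]) qs"] that
      by (metis image_eqI le_trans list.set_map mult_le_cancel1 zero_less_numeral)
    have "eval2 q (2, real (d - 1)) = 0" if q: "q \<in> set qs" for q
    proof -
      have q0: "eval2 q (real i, real j) = 0"
        if "i \<le> 2" "j \<le> d - 1" "(i, j) \<noteq> (2, d - 1)" for i j
        using q_zero[OF q p_zero[OF that]] .
      have "eval2 q (0, real (d - 1)) - 2 * eval2 q (1, real (d - 1)) + eval2 q (2, real (d - 1)) = 0"
      \<comment> \<open>With \<open>n = d - 1\<close> the total degree bound is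
        \<open>Suc n = d\<close>, and at the \<open>n\<close> heights below \<open>d - 1\<close> all
        three columns vanish.\<close>
      proof (rule eval2_second_difference_eq_0[where n = "d - 1"])
        show "coeff (coeff q j) i = 0" if "i + j > Suc (d - 1)" for i j
          using that assms
          by (intro coeff_eq_0_of_degree_lines_le[of _ d] line_degree[OF q]) auto
        show "eval2 q (0, real j) - 2 * eval2 q (1, real j) + eval2 q (2, real j) = 0"
          if "j < d - 1" for j
          using q0[of 0 j] q0[of 1 j] q0[of 2 j] that by simp
      qed
      \<comment> \<open>At height \<open>d - 1\<close> the columns 0 and 1 still vanish, so the
        second difference reduces to its last term.\<close>
      thus ?thesis using q0[of 0 "d - 1"] q0[of 1 "d - 1"] by simp
    qed
    hence "eval2 p (2, real (d - 1)) = 0"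
      unfolding sum_sq by (subst sum_list_nonneg_eq_0_iff) auto
    \<comment> \<open>Here the products in \<open>x + y\<close> have arguments \<open>d - 1\<close>
      and \<open>d - 3\<close>, each just beyond its last root.\<close>
    moreover have "0 < mixed_term d 2 (real (d - 1))"
      unfolding mixed_term_def using assms
      by (intro mult_pos_pos falling_pos) (auto simp: of_nat_diff)
    ultimately show False
      using c by (simp add: eval_p add_nonneg_pos order.strict_implies_not_eq[symmetric])
  qed
  ultimately show ?thesis
    using c unfolding p_def Let_def by blast
qed

end
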